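(* Let $\alpha>0$ and denote by $(P_s^\alpha)_{s\ge0}$ the Laguerre semi-group reversible with respect to $\nu_\alpha$. Then, for any $s>0$, there exists a constant $c$ (that depends only on $s$ and $\alpha$) such that for all non-negative real functions $f$ in $\mathbb{L}^1((0,\infty),\nu_\alpha)$ with $\int f\,d\nu_\alpha=1$, $$\nu_\alpha(\{P_s^\alpha f\ge t\})\le\frac{c}{t\sqrt{\log t}},\qquad t>1.$$
   Context: $\nu_\alpha$ is the Gamma probability distribution on $(0,\infty)$ with density $\varphi_\alpha(x)=\frac{1}{\Gamma(\alpha)}x^{\alpha-1}e^{-x}$, $x>0$. It is reversible for the Laguerre operator $L^\alpha f(x)=xf''(x)+(\alpha-x)f'(x)$, $x>0$, whose semi-group is, for $t>0$, $$P_t^\alpha f(x)=\int G_t^\alpha(x,y)f(y)\,d\nu_\alpha(y),$$ $$G_t^\alpha(x,y):=\frac{\Gamma(\alpha)e^t}{e^t-1}\Bigl(\frac{e^t}{xy}\Bigr)^{\frac{\alpha-1}{2}}\exp\Bigl\{-\frac{x+y}{e^t-1}\Bigr\}I_{\alpha-1}\Bigl(\frac{2\sqrt{xye^t}}{e^t-1}\Bigr),$$ where $I_\beta(x):=\sum_{n=0}^\infty\frac{1}{n!\,\Gamma(n+\beta+1)}\bigl(\frac x2\bigr)^{2n+\beta}$, $x>0$, is the modified Bessel function of the first kind of order $\beta>-1$. *)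

theory Defs
  imports "HOL-Analysis.Analysis"
begin

definition gamma_dens :: "real \<Rightarrow> real \<Rightarrow> real" where
  "gamma_dens \<alpha> x = 1 / Gamma \<alpha> * x powr (\<alpha> - 1) * exp (- x)"

text \<open>
  The underlying space of the Gamma distribution is the open half-line, so integrability and
  measurability with respect to it only involve the values of a function on \<open>{0<..}\<close>.
\<close>

definition gamma_distr :: "real \<Rightarrow> real measure" where
  "gamma_distr \<alpha> = density (restrict_space lborel {0<..}) (\<lambda>x. ennreal (gamma_dens \<alpha> x))"

text \<open>Modified Bessel function of the first kind, for order \<open>\<beta> > -1\<close> and argument \<open>x > 0\<close>.\<close>

definition bessel_I :: "real \<Rightarrow> real \<Rightarrow> real" where
  "bessel_I \<beta> x =
     (\<Sum>n. 1 / (fact n * Gamma (real n + \<beta> + 1)) * (x / 2) powr (2 * real n + \<beta>))"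

definition laguerre_kernel :: "real \<Rightarrow> real \<Rightarrow> real \<Rightarrow> real \<Rightarrow> real" where
  "laguerre_kernel \<alpha> t x y =
     Gamma \<alpha> * exp t / (exp t - 1)
     * (exp t / (x * y)) powr ((\<alpha> - 1) / 2)
     * exp (- ((x + y) / (exp t - 1)))
     * bessel_I (\<alpha> - 1) (2 * sqrt (x * y * exp t) / (exp t - 1))"

text \<open>
  The semi-group generated by \<open>x f''(x) + (\<alpha> - x) f'(x)\<close>, through its kernel with respect to the
  reversible measure. The kernel is defined for positive times only; at time \<open>0\<close> the
  semi-group is the identity.
\<close>

definition laguerre_semigroup :: "real \<Rightarrow> real \<Rightarrow> (real \<Rightarrow> real) \<Rightarrow> real \<Rightarrow> real" where
  "laguerre_semigroup \<alpha> t f x =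
     (if t = 0 then f x else (LINT y|gamma_distr \<alpha>. laguerre_kernel \<alpha> t x y * f y))"

end

theory Submission
  imports Defs "HOL-Real_Asymp.Real_Asymp"
begin

text \<open>
  The estimate follows from a pointwise bound on the kernel that is uniform in its second argument:
  \<open>G(x, y) \<le> C e\<^sup>x (1 + x) powr (1/2 - \<alpha>)\<close> for all \<open>x, y > 0\<close> (lemma \<open>laguerre_kernel_le\<close>).
  Integrating it against \<open>f\<close> shows that every \<open>P\<^sub>s f\<close> lies below the fixed function
  \<open>g(x) = C e\<^sup>x (1 + x) powr (1/2 - \<alpha>)\<close>, so that only the superlevel sets of \<open>g\<close> have to be
  measured. The set \<open>{g \<ge> t}\<close> is contained in a half-line starting within distance 1 of a point
  \<open>x\<close> with \<open>g(x) \<ge> t\<close>. The Gamma tail beyond \<open>x\<close> is of order \<open>x powr (\<alpha> - 1) * exp (-x)\<close>,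
  which is at most of order \<open>g(x)\<^sup>-\<^sup>1 / sqrt x \<le> 1 / (t * sqrt x)\<close>, and \<open>x\<close> is at least of order
  \<open>ln t\<close> when \<open>t\<close> is large (lemma \<open>gamma_distr_superlevel\<close>).

  For the kernel bound put \<open>b = 1 / (exp s - 1)\<close>. The Bessel series turns the kernel into
  \<open>\<Gamma>(\<alpha>) (1 + b) powr \<alpha>\<close> times \<open>exp (- b (x + y))\<close> times the sum over \<open>n\<close> of
  \<open>(b (1 + b) x y)^n / (n! \<Gamma>(n + \<alpha>))\<close>.
  Here the supremum over \<open>y\<close> may be taken in each term separately without losing the order of
  magnitude: \<open>(b y)^n exp (- b y)\<close> is at most \<open>2 n! / sqrt (n + 1)\<close>, by a Stirling lower bound for the
  factorial. Since \<open>1 / \<Gamma>(n + \<alpha>)\<close> is of order \<open>(1 + n) powr (1 - \<alpha>) / n!\<close>, what remains is the sum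
  over \<open>n\<close> of \<open>v^n / n! * (1 + n) powr (1/2 - \<alpha>)\<close> with \<open>v = (1 + b) x\<close>. Apart from the factor
  \<open>exp v\<close> it is a moment of a Poisson variable of mean \<open>v\<close>, and is of order
  \<open>exp v * (1 + v) powr (1/2 - \<alpha>)\<close> (lemma \<open>poisson_moment\<close>); finally \<open>exp v * exp (- b x) = exp x\<close>.
\<close>

section \<open>Factorials and the Gamma function\<close>

lemma stirling_step:
  fixes n :: nat
  assumes "n > 0"
  shows "(real n + 1/2) * (ln (real n + 1) - ln (real n)) \<le> 1 + (1 / real n - 1 / (real n + 1)) / 4"
proof -
  have "ln (real n + 1) - ln (real n) \<le> 1 * (inverse (real n) + inverse (real n + 1)) / 2"
    using assms by (intro ln_inverse_approx_le) auto
  then have "(real n + 1/2) * (ln (real n + 1) - ln (real n))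
      \<le> (real n + 1/2) * ((inverse (real n) + inverse (real n + 1)) / 2)"
    by (intro mult_left_mono) auto
  also have "\<dots> = 1 + (1 / real n - 1 / (real n + 1)) / 4"
    using assms by (simp add: divide_simps) (simp add: algebra_simps)
  finally show ?thesis .
qed

text \<open>
  The correction \<open>1 / (4 n)\<close> makes the induction close: its decrements equal the errors of
  the trapezoidal bound in \<open>stirling_step\<close>.
\<close>

lemma ln_fact_lower:
  fixes n :: nat
  assumes "n > 0"
  shows "ln (fact n) \<ge> (real n + 1/2) * ln (real n) - real n + 1 / (4 * real n)  + 3 / 4"
  using assms
proof (induction n rule: nat_induct_non_zero)
  case 1
  then show ?case by simp
next
  case (Suc n)
  define a b L where "a = 1 / real n" and "b = 1 / (real n + 1)" and "L = ln (real n + 1)"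
  define P Q where "P = (real n + 1/2) * L" and "Q = (real n + 1/2) * ln (real n)"
  have "fact (Suc n) = (real n + 1) * fact n" by (simp add: algebra_simps)
  then have ln_fact_Suc: "ln (fact (Suc n)) = L + ln (fact n :: real)"
    unfolding L_def by (simp only:) (subst ln_mult, auto)
  have "P - Q \<le> 1 + (a - b) / 4"
    unfolding L_def a_def b_def P_def Q_def right_diff_distrib [symmetric]
    using Suc.hyps by (rule stirling_step)
  moreover have "ln (fact n) \<ge> Q - real n + a / 4 + 3 / 4"
    using Suc.IH by (simp add: a_def Q_def mult.commute)
  ultimately have "P + L - (real n + 1) + b / 4 + 3 / 4 \<le> L + ln (fact n)"
    by argo
  also have "P + L = (real (Suc n) + 1/2) * ln (real (Suc n))"
    by (simp add: P_def L_def algebra_simps)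
  finally show ?case
    unfolding ln_fact_Suc by (simp add: b_def add.commute mult.commute)
qed

text \<open>
  Stirling's lower bound, with \<open>n + 1\<close> under the square root so that it is of use for \<open>n = 0\<close> too.
\<close>

lemma fact_lower:
  "real n ^ n * exp (- real n) * sqrt (real n + 1) \<le> 2 * fact n"
proof (cases "n = 0")
  case False
  then have n: "real n > 0" by simp
  have "ln (real n ^ n * exp (- real n) * sqrt (real n)) = (real n + 1/2) * ln (real n) - real n"
    using n by (simp add: ln_mult ln_realpow ln_sqrt algebra_simps)
  also have "\<dots> \<le> ln (fact n)"
  proof -
    have "0 \<le> 1 / (4 * real n) + 3 / 4" by simp
    then show ?thesis using ln_fact_lower[of n] False by linarith
  qed
  finally have *: "real n ^ n * exp (- real n) * sqrt (real n) \<le> fact n"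
    using n by (subst (asm) ln_le_cancel_iff) auto
  have "sqrt (real n + 1) \<le> sqrt (4 * real n)"
    using False by (intro real_sqrt_le_mono) auto
  then have "sqrt (real n + 1) \<le> 2 * sqrt (real n)"
    by (simp add: real_sqrt_mult)
  then have "real n ^ n * exp (- real n) * sqrt (real n + 1)
      \<le> real n ^ n * exp (- real n) * (2 * sqrt (real n))"
    by (intro mult_left_mono) auto
  with * show ?thesis by simp
qed auto

text \<open>The function \<open>z^n exp (-z)\<close> attains its maximum at \<open>z = n\<close>, where \<open>fact_lower\<close> applies.\<close>

lemma power_times_exp_le:
  fixes z :: real
  assumes "z \<ge> 0"
  shows "z ^ n * exp (- z) \<le> 2 * fact n / sqrt (real n + 1)"
proof -
  have "z ^ n * exp (- z) \<le> real n ^ n * exp (- real n)"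
  proof (cases "n = 0")
    case False
    have "z / real n \<le> exp (z / real n - 1)"
      using exp_ge_add_one_self[of "z / real n - 1"] by simp
    then have "(z / real n) ^ n \<le> exp (z / real n - 1) ^ n"
      using assms by (intro power_mono) auto
    also have "\<dots> = exp (z - real n)"
      using False by (simp add: exp_of_nat_mult[symmetric] algebra_simps)
    finally show ?thesis
      using False by (simp add: power_divide exp_diff exp_minus field_simps)
  qed (use assms in auto)
  also have "\<dots> \<le> 2 * fact n / sqrt (real n + 1)"
    using fact_lower[of n] by (simp add: field_simps)
  finally show ?thesis .
qed

text \<open>
  Two positive quantities that agree up to a factor \<open>q\<close> have powers that agree up to a factor
  \<open>q powr \<bar>\<beta>\<bar>\<close>, whatever the sign of the exponent.
\<close>

lemma powr_le_powr_of_comparable: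
  fixes u v q \<beta> :: real
  assumes "u > 0" "v > 0" "q > 0" "u \<le> q * v" "v \<le> q * u"
  shows "u powr \<beta> \<le> q powr \<bar>\<beta>\<bar> * v powr \<beta>"
proof (cases "\<beta> \<ge> 0")
  case True
  then have "u powr \<beta> \<le> (q * v) powr \<beta>"
    using assms by (intro powr_mono2) auto
  then show ?thesis using True by (simp add: powr_mult)
next
  case False
  have "u powr \<beta> \<le> (v / q) powr \<beta>"
    using assms False by (intro powr_mono2') (auto simp: field_simps)
  then show ?thesis
    using False assms by (simp add: powr_divide powr_minus field_simps)
qed

lemma inverse_Gamma_le:
  fixes \<alpha> :: real
  assumes "\<alpha> > 0"
  obtains C where "C > 0"
    "\<And>n::nat. 1 / Gamma (real n + \<alpha>) \<le> C * (1 + real n) powr (1 - \<alpha>) / fact n"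
proof -
  have nonpos: "\<alpha> \<notin> \<int>\<^sub>\<le>\<^sub>0"
    using assms by (auto elim!: nonpos_Ints_cases)
  \<comment> \<open>Euler's limit: \<open>(n - 1)! n powr \<alpha> \<Gamma>(\<alpha>) / \<Gamma>(n + \<alpha>)\<close> converges, hence is bounded.\<close>
  have "convergent (Gamma_series' \<alpha>)"
    using Gamma_series'_LIMSEQ[of \<alpha>] by (auto simp: convergent_def)
  then obtain B where B: "B > 0" "\<And>n. norm (Gamma_series' \<alpha> n) \<le> B"
    by (auto dest!: convergent_imp_Bseq elim!: BseqE)
  \<comment> \<open>The second summand covers \<open>n = 0\<close>; the factor in front of the first passes from \<open>n\<close> to \<open>1 + n\<close>.\<close>
  define C where "C = 2 powr \<bar>1 - \<alpha>\<bar> * B / Gamma \<alpha> + 1 / Gamma \<alpha>"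
  have G: "Gamma (real n + \<alpha>) > 0" for n using assms by (intro Gamma_real_pos) auto
  have G0: "Gamma \<alpha> > 0" using assms by (intro Gamma_real_pos) auto
  show thesis
  proof (rule that[of C])
    show "C > 0" using B G0 by (auto simp: C_def intro!: add_nonneg_pos divide_nonneg_pos)
    fix n :: nat
    show "1 / Gamma (real n + \<alpha>) \<le> C * (1 + real n) powr (1 - \<alpha>) / fact n"
    proof (cases "n = 0")
      case True
      then show ?thesis using B G0 by (simp add: C_def)
    next
      case False
      then have n: "real n > 0" by simp
      have "Gamma_series' \<alpha> n = fact (n - 1) * real n powr \<alpha> * Gamma \<alpha> / Gamma (real n + \<alpha>)"
        using n nonpos by (simp add: Gamma_series'_def pochhammer_Gamma powr_def add.commute mult.commute)
      also have "\<dots> = fact n * real n powr (\<alpha> - 1) * Gamma \<alpha> / Gamma (real n + \<alpha>)"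
        using False by (simp add: fact_reduce[of n] powr_diff)
      finally have "fact n * real n powr (\<alpha> - 1) * Gamma \<alpha> / Gamma (real n + \<alpha>) \<le> B"
        using B(2)[of n] by (metis abs_le_D1 real_norm_def)
      then have "fact n * real n powr (\<alpha> - 1) * Gamma \<alpha> / Gamma (real n + \<alpha>) * (real n powr (1 - \<alpha>) / (fact n * Gamma \<alpha>))
         \<le> B * (real n powr (1 - \<alpha>) / (fact n * Gamma \<alpha>))"
        using G0 by (intro mult_right_mono) auto
      moreover have "real n powr (\<alpha> - 1) * real n powr (1 - \<alpha>) = 1"
        using n by (simp add: powr_add[symmetric])
      ultimately have 1: "1 / Gamma (real n + \<alpha>) \<le> B / Gamma \<alpha> * real n powr (1 - \<alpha>) / fact n"
        using G0 by (simp add: field_simps)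
      have "real n powr (1 - \<alpha>) \<le> 2 powr \<bar>1 - \<alpha>\<bar> * (1 + real n) powr (1 - \<alpha>)"
        using False by (intro powr_le_powr_of_comparable) auto
      then have "B / Gamma \<alpha> * real n powr (1 - \<alpha>) / fact n
          \<le> B / Gamma \<alpha> * (2 powr \<bar>1 - \<alpha>\<bar> * (1 + real n) powr (1 - \<alpha>)) / fact n"
        using B G0 by (intro divide_right_mono mult_left_mono) auto
      also have "\<dots> = B / Gamma \<alpha> * 2 powr \<bar>1 - \<alpha>\<bar> * (1 + real n) powr (1 - \<alpha>) / fact n"
        by (simp add: mult.assoc)
      also have "\<dots> \<le> C * (1 + real n) powr (1 - \<alpha>) / fact n"
        using G0 by (intro divide_right_mono mult_right_mono) (auto simp: C_def mult.commute)
      finally show ?thesis using 1 by linarith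
    qed
  qed
qed

section \<open>Moments of the Poisson distribution\<close>

lemma exp_series: "(\<lambda>n. v ^ n / fact n) sums exp (v::real)"
  using exp_converges[of v] by (simp add: field_simps)

text \<open>
  For a Poisson variable \<open>N\<close> of mean \<open>v\<close> this says that the expectation of \<open>(1 + N) powr \<beta>\<close> is at most
  a constant times \<open>(1 + v) powr \<beta>\<close>. With \<open>r = (1 + N) / (1 + v)\<close> and a natural number
  \<open>k \<ge> - \<beta>\<close> one has \<open>r powr \<beta> \<le> r + r powr (- k)\<close>. The expectation of \<open>r\<close> is 1; the negative integer
  moment is controlled by comparing \<open>(1 + n)^k\<close> with \<open>(n + k)! / n!\<close>, which turns it into a
  shifted exponential series.
\<close>

lemma poisson_moment:
  fixes \<beta> :: real
  assumes "\<beta> \<le> 1"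
  obtains C where "C > 0"
    "\<And>v. v \<ge> 0 \<Longrightarrow> summable (\<lambda>n. v ^ n / fact n * (1 + real n) powr \<beta>)"
    "\<And>v. v \<ge> 0 \<Longrightarrow> (\<Sum>n. v ^ n / fact n * (1 + real n) powr \<beta>) \<le> C * exp v * (1 + v) powr \<beta>"
proof -
  define k where "k = nat \<lceil>- \<beta>\<rceil>"
  have k: "- real k \<le> \<beta>" unfolding k_def by linarith
  define C :: real where "C = 1 + 2 ^ k * (1 + fact k)"
  have main: "summable (\<lambda>n. v ^ n / fact n * (1 + real n) powr \<beta>) \<and>
      (\<Sum>n. v ^ n / fact n * (1 + real n) powr \<beta>) \<le> C * exp v * (1 + v) powr \<beta>"
    if v: "v \<ge> 0" for v
  proof -
    \<comment> \<open>The termwise majorant, in which the sum of each part is explicit.\<close>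
    define h where "h n = (1 + v) powr \<beta> * (v ^ n / fact n * ((1 + real n) / (1 + v))
        + 2 ^ k * (v ^ n / fact n + fact k * (v ^ (n + k) / fact (n + k))))" for n
    have le: "v ^ n / fact n * (1 + real n) powr \<beta> \<le> h n" for n
    proof -
      define r where "r = (1 + real n) / (1 + v)"
      have r: "r > 0" using v by (simp add: r_def)
      have "r powr \<beta> \<le> r + r powr (- real k)"
      proof (cases "r \<ge> 1")
        case True
        then have "r powr \<beta> \<le> r powr 1" using assms by (intro powr_mono) auto
        then show ?thesis using r by (simp add: add_increasing2)
      next
        case False
        then have "r powr \<beta> \<le> r powr (- real k)" using k r by (intro powr_mono') auto
        then show ?thesis using r by simp
      qed
      also have "r powr (- real k) = (1 + v) ^ k / (1 + real n) ^ k"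
        using r v by (simp add: powr_minus powr_realpow r_def power_divide)
      finally have "v ^ n / fact n * r powr \<beta> \<le> v ^ n / fact n * (r + (1 + v) ^ k / (1 + real n) ^ k)"
        using v by (intro mult_left_mono) auto
      also have "\<dots> = v ^ n / fact n * r + v ^ n / fact n * ((1 + v) ^ k / (1 + real n) ^ k)"
        by (simp add: algebra_simps)
      also have "v ^ n / fact n * ((1 + v) ^ k / (1 + real n) ^ k)
          \<le> 2 ^ k * (v ^ n / fact n + fact k * (v ^ (n + k) / fact (n + k)))"
      proof -
        have "(1 + v) ^ k \<le> (2 * max 1 v) ^ k"
          using v by (intro power_mono) auto
        also have "\<dots> \<le> 2 ^ k * (1 + v ^ k)"
          using v by (cases "v \<le> 1") (auto simp: power_mult_distrib max_def)
        finally have "v ^ n / fact n * ((1 + v) ^ k / (1 + real n) ^ k)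
            \<le> v ^ n / fact n * (2 ^ k * (1 + v ^ k) / (1 + real n) ^ k)"
          using v by (intro mult_left_mono divide_right_mono) auto
        also have "\<dots> = 2 ^ k * (v ^ n / (fact n * (1 + real n) ^ k)
            + v ^ (n + k) / (fact n * (1 + real n) ^ k))"
          by (simp add: field_simps power_add)
        also have "\<dots> \<le> 2 ^ k * (v ^ n / fact n + v ^ (n + k) * (fact k / fact (n + k)))"
        proof -
          have a: "1 * fact n \<le> fact n * (1 + real n) ^ k" by simp
          have "fact (n + k) \<le> fact k * (fact n * (1 + real n) ^ k)"
          proof (induction k)
            case (Suc k)
            have "fact (n + Suc k) = (real n + real k + 1) * fact (n + k)"
              by (simp add: algebra_simps)
            also have "\<dots> \<le> ((real k + 1) * (1 + real n)) * (fact k * (fact n * (1 + real n) ^ k))"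
              using Suc by (intro mult_mono) (auto simp: algebra_simps)
            finally show ?case by (simp add: algebra_simps)
          qed auto
          then have "1 / (fact n * (1 + real n) ^ k) \<le> fact k / fact (n + k)"
            by (simp add: field_simps)
          then have "v ^ (n + k) * (1 / (fact n * (1 + real n) ^ k)) \<le> v ^ (n + k) * (fact k / fact (n + k))"
            using v by (intro mult_left_mono) auto
          moreover have "v ^ n / (fact n * (1 + real n) ^ k) \<le> v ^ n / fact n"
            using a v by (intro divide_left_mono) auto
          ultimately show ?thesis by simp
        qed
        also have "\<dots> = 2 ^ k * (v ^ n / fact n + fact k * (v ^ (n + k) / fact (n + k)))"
          by simp
        finally show ?thesis .
      qed
      finally have "v ^ n / fact n * r powr \<beta>
          \<le> v ^ n / fact n * r + 2 ^ k * (v ^ n / fact n + fact k * (v ^ (n + k) / fact (n + k)))"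
        by simp
      then have "(1 + v) powr \<beta> * (v ^ n / fact n * r powr \<beta>) \<le> h n"
        unfolding h_def r_def[symmetric] by (intro mult_left_mono) auto
      moreover have "(1 + v) powr \<beta> * r powr \<beta> = (1 + real n) powr \<beta>"
        using v r by (simp add: powr_mult[symmetric] r_def)
      ultimately show ?thesis by (simp add: mult_ac)
    qed
    have shift: "(\<lambda>n. v ^ (n + k) / fact (n + k)) sums (exp v - (\<Sum>i<k. v ^ i / fact i))"
      using sums_split_initial_segment[OF exp_series[of v], of k] .
    define t where "t = exp v - (\<Sum>i<k. v ^ i / fact i)"
    have t: "t \<le> exp v" using v by (simp add: t_def sum_nonneg)
    have mean: "(\<lambda>n. v ^ n / fact n * (1 + real n)) sums (exp v * (1 + v))"
    proof -
      have "(\<lambda>n. real (Suc n) * (v ^ Suc n / fact (Suc n))) sums (v * exp v)"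
        using sums_mult[OF exp_series[of v], of v]
        by (simp add: field_simps del: of_nat_Suc)
      then have "(\<lambda>n. real n * (v ^ n / fact n)) sums (v * exp v)"
        using sums_Suc_iff[of "\<lambda>n. real n * (v ^ n / fact n)" "v * exp v"] by simp
      from sums_add[OF exp_series[of v] this] show ?thesis
        by (simp add: add_divide_distrib distrib_left distrib_right mult_ac)
    qed
    have "h sums ((1 + v) powr \<beta> * (exp v * (1 + v) / (1 + v) + 2 ^ k * (exp v + fact k * t)))"
      unfolding h_def
      using sums_divide[OF mean, of "1 + v"] exp_series[of v] shift
      by (intro sums_mult sums_add) (auto simp: t_def)
    moreover have "(1 + v) powr \<beta> * (exp v * (1 + v) / (1 + v) + 2 ^ k * (exp v + fact k * t))
        \<le> (1 + v) powr \<beta> * (exp v * (1 + v) / (1 + v) + 2 ^ k * (exp v + fact k * exp v))"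
      using t by (intro mult_left_mono add_left_mono) auto
    moreover have "\<dots> = C * exp v * (1 + v) powr \<beta>"
      using v by (subst nonzero_mult_div_cancel_right) (auto simp: C_def algebra_simps)
    ultimately obtain S where S: "h sums S" "S \<le> C * exp v * (1 + v) powr \<beta>" by metis
    have summ: "summable (\<lambda>n. v ^ n / fact n * (1 + real n) powr \<beta>)"
      by (rule summable_comparison_test'[OF sums_summable[OF S(1)], of 0]) (use v le in auto) 
    then show ?thesis
      using sums_le[OF le summable_sums[OF summ] S(1)] S(2) by auto
  qed
  have "C > 0" by (simp add: C_def add_pos_nonneg)
  then show thesis using that[of C] main by blast
qed


section \<open>A kernel bound uniform in the second variable\<close>

lemma square_powr_half: "w > 0 \<Longrightarrow> (w\<^sup>2) powr (a / 2) = w powr a" for w a :: real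
  by (simp add: powr_powr flip: powr_numeral)

lemma laguerre_kernel_le:
  fixes \<alpha> s :: real
  assumes "\<alpha> > 0" "s > 0"
  obtains C where "C > 0"
    "\<And>x y. x > 0 \<Longrightarrow> y > 0 \<Longrightarrow> laguerre_kernel \<alpha> s x y \<le> C * exp x * (1 + x) powr (1/2 - \<alpha>)"
proof -
  define b where "b = 1 / (exp s - 1)"
  have b: "b > 0" using assms by (simp add: b_def)
  have bs: "exp s * b = 1 + b" using assms by (simp add: b_def field_simps)
  define \<beta> where "\<beta> = 1/2 - \<alpha>"
  obtain C1 where C1: "C1 > 0"
    "\<And>n::nat. 1 / Gamma (real n + \<alpha>) \<le> C1 * (1 + real n) powr (1 - \<alpha>) / fact n"
    using inverse_Gamma_le[OF assms(1)] by blast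
  have "\<beta> \<le> 1" using assms by (simp add: \<beta>_def)
  then obtain C2 where C2: "C2 > 0"
    "\<And>v. v \<ge> 0 \<Longrightarrow> summable (\<lambda>n. v ^ n / fact n * (1 + real n) powr \<beta>)"
    "\<And>v. v \<ge> 0 \<Longrightarrow> (\<Sum>n. v ^ n / fact n * (1 + real n) powr \<beta>) \<le> C2 * exp v * (1 + v) powr \<beta>"
    using poisson_moment[of \<beta>] by blast
  have G: "Gamma (real n + \<alpha>) > 0" for n using assms by (intro Gamma_real_pos) auto
  have G0: "Gamma \<alpha> > 0" using assms by (intro Gamma_real_pos) auto
  define K where "K = (1 + b) powr (\<alpha> - 1) * (2 * C1)"
  have K: "K > 0" using b C1 by (simp add: K_def)
  define C where "C = Gamma \<alpha> * (1 + b) * (K * C2 * (1 + b) powr \<bar>\<beta>\<bar>)"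
  show thesis
  proof (rule that[of C])
    show "C > 0" using b G0 K C2 by (simp add: C_def)
    fix x y :: real
    assume x: "x > 0" and y: "y > 0"
    \<comment> \<open>\<open>w\<close> is half the argument of the Bessel function, \<open>T n\<close> the terms of its series and \<open>M n\<close>,
      up to a factor independent of \<open>n\<close>, their majorant.\<close>
    define v where "v = (1 + b) * x"
    define A where "A = (exp s / (x * y)) powr ((\<alpha> - 1) / 2)"
    define w where "w = sqrt (x * y * exp s) * b"
    define T where "T n = 1 / (fact n * Gamma (real n + \<alpha>)) * w powr (2 * real n + (\<alpha> - 1))" for n
    define M where "M n = v ^ n / fact n * (1 + real n) powr \<beta>" for n
    have v: "v \<ge> 0" using b x by (simp add: v_def)
    have w: "w > 0" using x y b by (simp add: w_def)
    have ww: "w\<^sup>2 = x * y * exp s * b\<^sup>2"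
      using x y by (simp add: w_def power_mult_distrib)
    have w2: "w\<^sup>2 = v * (b * y)"
    proof -
      have "w\<^sup>2 = x * y * b * (exp s * b)"
        unfolding ww by (simp add: power2_eq_square mult_ac)
      then show ?thesis unfolding bs by (simp add: v_def mult_ac)
    qed
    have A: "A > 0" using x y by (simp add: A_def)
    have Aw: "A * w powr (2 * real n + (\<alpha> - 1)) = (1 + b) powr (\<alpha> - 1) * (v * (b * y)) ^ n" for n
    proof -
      have "w powr (\<alpha> - 1) = (w\<^sup>2) powr ((\<alpha> - 1) / 2)"
        using square_powr_half[OF w] by simp
      then have "A * w powr (\<alpha> - 1) = (exp s / (x * y) * w\<^sup>2) powr ((\<alpha> - 1) / 2)"
        by (subst powr_mult) (use x y in \<open>auto simp: A_def\<close>)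
      also have "exp s / (x * y) * w\<^sup>2 = (exp s * b)\<^sup>2"
        unfolding ww using x y by (simp add: power_mult_distrib power2_eq_square)
      also have "(exp s * b)\<^sup>2 powr ((\<alpha> - 1) / 2) = (1 + b) powr (\<alpha> - 1)"
        unfolding bs using b by (intro square_powr_half) auto
      finally have 1: "A * w powr (\<alpha> - 1) = (1 + b) powr (\<alpha> - 1)" .
      have "w powr (2 * real n) = (w\<^sup>2) ^ n"
        using w by (simp add: powr_realpow[symmetric] powr_powr flip: powr_numeral)
      with 1 show ?thesis
        by (simp add: powr_add w2 mult_ac)
    qed
    have T0: "T n \<ge> 0" for n using G[of n] by (simp add: T_def)
    have TM: "T n \<le> K / (A * exp (- (b * y))) * M n" for n
    proof -
      have "A * exp (- (b * y)) * T n = 1 / (fact n * Gamma (real n + \<alpha>)) * exp (- (b * y))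
          * (A * w powr (2 * real n + (\<alpha> - 1)))"
        by (simp add: T_def)
      also have "\<dots> = (1 + b) powr (\<alpha> - 1) * v ^ n * (((b * y) ^ n * exp (- (b * y))) / fact n)
          * (1 / Gamma (real n + \<alpha>))"
        unfolding Aw by (simp add: power_mult_distrib)
      also have "\<dots> \<le> (1 + b) powr (\<alpha> - 1) * v ^ n * ((2 * fact n / sqrt (real n + 1)) / fact n)
          * (C1 * (1 + real n) powr (1 - \<alpha>) / fact n)"
        using b y v G[of n] by (intro mult_mono C1 divide_right_mono power_times_exp_le) auto
      also have "\<dots> = K * (v ^ n / fact n * ((1 + real n) powr (1 - \<alpha>) / sqrt (1 + real n)))"
        by (simp add: K_def add.commute mult_ac)
      also have "(1 + real n) powr (1 - \<alpha>) / sqrt (1 + real n) = (1 + real n) powr \<beta>"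
        by (simp add: \<beta>_def powr_diff[symmetric] flip: powr_half_sqrt)
      finally show ?thesis
        using A by (simp add: M_def field_simps)
    qed
    have sM: "summable M" unfolding M_def using C2(2)[OF v] .
    then have sKM: "summable (\<lambda>n. K / (A * exp (- (b * y))) * M n)" by (rule summable_mult)
    have sT: "summable T"
      using T0 TM by (intro summable_comparison_test'[OF sKM, of 0]) auto
    have comp: "(1 + v) powr \<beta> \<le> (1 + b) powr \<bar>\<beta>\<bar> * (1 + x) powr \<beta>"
    proof (rule powr_le_powr_of_comparable)
      have "b * x \<ge> 0" "b * (b * x) \<ge> 0" using b x by auto
      then show "1 + v \<le> (1 + b) * (1 + x)" "1 + x \<le> (1 + b) * (1 + v)"
        using b x by (auto simp: v_def algebra_simps)
    qed (use b x v in auto)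
    have "2 * q / d / 2 = q * (1 / d)" for q d :: real by simp
    then have "2 * sqrt (x * y * exp s) / (exp s - 1) / 2 = w"
      unfolding w_def b_def .
    then have "bessel_I (\<alpha> - 1) (2 * sqrt (x * y * exp s) / (exp s - 1)) = suminf T"
      unfolding bessel_I_def T_def by simp
    also have "\<dots> \<le> (\<Sum>n. K / (A * exp (- (b * y))) * M n)"
      by (rule suminf_le[OF TM sT sKM])
    also have "\<dots> = K / (A * exp (- (b * y))) * suminf M"
      by (rule suminf_mult[OF sM])
    also have "\<dots> \<le> K / (A * exp (- (b * y))) * (C2 * exp v * (1 + v) powr \<beta>)"
      unfolding M_def using C2(3)[OF v] K A by (intro mult_left_mono) auto
    also have "\<dots> \<le> K / (A * exp (- (b * y)))
        * (C2 * exp v * ((1 + b) powr \<bar>\<beta>\<bar> * (1 + x) powr \<beta>))"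
      using comp K A C2(1) by (intro mult_left_mono) auto
    finally have "bessel_I (\<alpha> - 1) (2 * sqrt (x * y * exp s) / (exp s - 1))
        \<le> K / (A * exp (- (b * y))) * (C2 * exp v * ((1 + b) powr \<bar>\<beta>\<bar> * (1 + x) powr \<beta>))" .
    then have "Gamma \<alpha> * (1 + b) * A * exp (- (b * (x + y))) *
        bessel_I (\<alpha> - 1) (2 * sqrt (x * y * exp s) / (exp s - 1))
      \<le> Gamma \<alpha> * (1 + b) * A * exp (- (b * (x + y))) *
        (K / (A * exp (- (b * y))) * (C2 * exp v * ((1 + b) powr \<bar>\<beta>\<bar> * (1 + x) powr \<beta>)))"
      using G0 b A by (intro mult_left_mono) auto
    also have "\<dots> = C * (exp (- (b * (x + y))) * exp v / exp (- (b * y))) * (1 + x) powr \<beta>"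
      using A by (simp add: C_def field_simps)
    also have "exp (- (b * (x + y))) * exp v / exp (- (b * y)) = exp x"
      by (simp add: v_def algebra_simps flip: exp_add exp_diff)
    also have "Gamma \<alpha> * (1 + b) * A * exp (- (b * (x + y))) *
        bessel_I (\<alpha> - 1) (2 * sqrt (x * y * exp s) / (exp s - 1)) = laguerre_kernel \<alpha> s x y"
    proof -
      have "Gamma \<alpha> * (1 + b) = Gamma \<alpha> * exp s / (exp s - 1)"
        by (simp add: bs[symmetric]) (simp add: b_def)
      moreover have "b * (x + y) = (x + y) / (exp s - 1)" by (simp add: b_def)
      ultimately show ?thesis by (simp only: laguerre_kernel_def A_def)
    qed
    finally show "laguerre_kernel \<alpha> s x y \<le> C * exp x * (1 + x) powr (1/2 - \<alpha>)"
      by (simp add: \<beta>_def)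
  qed
qed

section \<open>Tails and superlevel sets under the Gamma distribution\<close>

lemma space_gamma_distr [simp]: "space (gamma_distr \<alpha>) = {0<..}"
  by (simp add: gamma_distr_def)

lemma emeasure_gamma_distr:
  assumes "A \<in> sets borel" "A \<subseteq> {0<..}"
  shows "A \<in> sets (gamma_distr \<alpha>)"
    and "emeasure (gamma_distr \<alpha>) A = (\<integral>\<^sup>+x. ennreal (gamma_dens \<alpha> x) * indicator A x \<partial>lborel)"
proof -
  have A: "A \<in> sets (restrict_space lborel {0<..})"
    using assms by (auto simp: sets_restrict_space)
  then show "A \<in> sets (gamma_distr \<alpha>)" by (simp add: gamma_distr_def)
  have [measurable]: "gamma_dens \<alpha> \<in> borel_measurable borel"
    unfolding gamma_dens_def[abs_def] by measurable
  have "(\<lambda>x. ennreal (gamma_dens \<alpha> x)) \<in> borel_measurable (restrict_space lborel {0<..})"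
    by (intro measurable_restrict_space1) measurable
  then have "emeasure (gamma_distr \<alpha>) A
      = (\<integral>\<^sup>+x. ennreal (gamma_dens \<alpha> x) * indicator A x \<partial>restrict_space lborel {0<..})"
    unfolding gamma_distr_def using A by (rule emeasure_density)
  also have "\<dots> = (\<integral>\<^sup>+x. ennreal (gamma_dens \<alpha> x) * indicator A x * indicator {0<..} x \<partial>lborel)"
    by (rule nn_integral_restrict_space) simp
  also have "\<dots> = (\<integral>\<^sup>+x. ennreal (gamma_dens \<alpha> x) * indicator A x \<partial>lborel)"
    using assms(2) by (intro nn_integral_cong) (auto simp: indicator_def)
  finally show "emeasure (gamma_distr \<alpha>) A
      = (\<integral>\<^sup>+x. ennreal (gamma_dens \<alpha> x) * indicator A x \<partial>lborel)" .
qed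

lemma finite_measure_gamma_distr:
  assumes "\<alpha> > 0"
  shows "finite_measure (gamma_distr \<alpha>)"
proof
  have "Gamma \<alpha> > 0" using assms by (rule Gamma_real_pos)
  then have "emeasure (gamma_distr \<alpha>) {0<..}
      \<le> (\<integral>\<^sup>+t. ennreal (1 / Gamma \<alpha>) * ennreal (indicator {0..} t * t powr (\<alpha> - 1) / exp t) \<partial>lborel)"
    unfolding emeasure_gamma_distr(2)[OF _ order_refl, simplified]
    by (intro nn_integral_mono)
      (auto simp: gamma_dens_def indicator_def exp_minus field_simps simp flip: ennreal_mult'')
  also have "\<dots> = ennreal (1 / Gamma \<alpha>) * ennreal (Gamma \<alpha>)"
    by (subst nn_integral_cmult) (auto simp: Gamma_conv_nn_integral_real[OF assms])
  also have "\<dots> < \<infinity>" by (simp add: ennreal_mult_less_top)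
  finally show "emeasure (gamma_distr \<alpha>) (space (gamma_distr \<alpha>)) \<noteq> \<infinity>" by simp
qed

text \<open>
  Beyond \<open>x\<close> the density at \<open>y\<close> is compared with its order of magnitude at \<open>x\<close> times \<open>exp (- (y - x) / 2)\<close>:
  half of the exponential decay absorbs the factor \<open>(y / (1 + x)) powr (\<alpha> - 1)\<close>,
  which is at most a power of \<open>2 * (1 + (y - x))\<close>.
\<close>

lemma gamma_distr_tail:
  fixes \<alpha> :: real
  assumes "\<alpha> > 0"
  obtains C where "C > 0"
    "\<And>x. x \<ge> 1 \<Longrightarrow> measure (gamma_distr \<alpha>) {x..} \<le> C * (1 + x) powr (\<alpha> - 1) * exp (- x)"
proof -
  \<comment> \<open>Adding 1 keeps \<open>p\<close> positive, so that it may be divided by, also for \<open>\<alpha> = 1\<close>.\<close>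
  define p where "p = \<bar>\<alpha> - 1\<bar> + 1"
  have p: "p \<ge> 1" by (simp add: p_def)
  have G0: "Gamma \<alpha> > 0" using assms by (intro Gamma_real_pos) auto
  define K where "K = (4 * p) powr p / Gamma \<alpha>"
  have K: "K > 0" using p G0 by (simp add: K_def)
  have dens: "gamma_dens \<alpha> y \<le> K * (1 + x) powr (\<alpha> - 1) * exp (- x) * exp (- ((y - x) / 2))"
    if "1 \<le> x" "x \<le> y" for x y
  proof -
    define w where "w = y - x"
    have w: "w \<ge> 0" using that by (simp add: w_def)
    have "y \<le> (1 + w) * (1 + x)"
    proof -
      have "(1 + w) * (1 + x) = 1 + (x + w) + w * x" by (simp add: algebra_simps)
      moreover have "w * x \<ge> 0" "x + w = y" using w that by (auto simp: w_def)
      ultimately show ?thesis by linarith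
    qed
    also have "\<dots> \<le> 2 * (1 + w) * (1 + x)" using w that by simp
    finally have "y \<le> 2 * (1 + w) * (1 + x)" .
    moreover have "1 + x \<le> 2 * (1 + w) * y"
    proof -
      have "1 * y \<le> (1 + w) * y" using w that by (intro mult_right_mono) auto
      moreover have "1 + x \<le> 2 * y" using that by simp
      ultimately have "1 + x \<le> 2 * ((1 + w) * y)" by linarith
      then show ?thesis by (simp only: mult.assoc)
    qed
    ultimately have "y powr (\<alpha> - 1) \<le> (2 * (1 + w)) powr \<bar>\<alpha> - 1\<bar> * (1 + x) powr (\<alpha> - 1)"
      using that w by (intro powr_le_powr_of_comparable) auto
    also have "(2 * (1 + w)) powr \<bar>\<alpha> - 1\<bar> \<le> (2 * (1 + w)) powr p"
      using w by (intro powr_mono) (auto simp: p_def)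
    also have "\<dots> \<le> (4 * p * exp (w / (2 * p))) powr p"
    proof (rule powr_mono2)
      have "2 * (1 + w) \<le> 4 * p * (1 + w / (2 * p))"
        using p w by (simp add: field_simps)
      also have "\<dots> \<le> 4 * p * exp (w / (2 * p))"
        using p by (intro mult_left_mono exp_ge_add_one_self) auto
      finally show "2 * (1 + w) \<le> 4 * p * exp (w / (2 * p))" .
    qed (use p w in auto)
    also have "\<dots> = (4 * p) powr p * exp (w / 2)"
      using p by (simp add: powr_mult exp_powr_real)
    finally have "y powr (\<alpha> - 1) \<le> (4 * p) powr p * exp (w / 2) * (1 + x) powr (\<alpha> - 1)"
      by (simp add: mult_right_mono)
    then have "1 / Gamma \<alpha> * y powr (\<alpha> - 1) * exp (- y)
        \<le> 1 / Gamma \<alpha> * ((4 * p) powr p * exp (w / 2) * (1 + x) powr (\<alpha> - 1)) * exp (- y)"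
      using G0 by (intro mult_right_mono mult_left_mono) auto
    also have "\<dots> = K * (1 + x) powr (\<alpha> - 1) * (exp (w / 2) * exp (- y))"
      by (simp add: K_def)
    also have "exp (w / 2) * exp (- y) = exp (- x) * exp (- ((y - x) / 2))"
      by (simp add: w_def field_simps flip: exp_add)
    finally show ?thesis by (simp add: gamma_dens_def mult.assoc)
  qed
  show thesis
  proof (rule that[of "2 * K"])
    fix x :: real
    assume x: "x \<ge> 1"
    define D where "D = K * (1 + x) powr (\<alpha> - 1) * exp (- x)"
    have D: "D \<ge> 0" using K by (simp add: D_def)
    have int: "(\<integral>\<^sup>+y. ennreal (exp (- ((y - x) / 2))) * indicator {x..} y \<partial>lborel)
        = ennreal (0 - (- 2 * exp (- ((x - x) / 2))))"
    proof (rule nn_integral_FTC_atLeast[where F = "\<lambda>y. - 2 * exp (- ((y - x) / 2))"])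
      show "((\<lambda>y. - 2 * exp (- ((y - x) / 2))) \<longlongrightarrow> 0) at_top"
        by real_asymp
    qed (auto intro!: derivative_eq_intros)
    have "{x..} \<subseteq> {0<..}" using x by auto
    then have "emeasure (gamma_distr \<alpha>) {x..}
        = (\<integral>\<^sup>+y. ennreal (gamma_dens \<alpha> y) * indicator {x..} y \<partial>lborel)"
      by (intro emeasure_gamma_distr) auto
    also have "\<dots> \<le> (\<integral>\<^sup>+y. ennreal D * (ennreal (exp (- ((y - x) / 2))) * indicator {x..} y) \<partial>lborel)"
      using dens[OF x] D
      by (intro nn_integral_mono)
        (auto simp: indicator_def D_def ennreal_mult'[symmetric] intro!: ennreal_leI)
    also have "\<dots> = ennreal D * (\<integral>\<^sup>+y. ennreal (exp (- ((y - x) / 2))) * indicator {x..} y \<partial>lborel)"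
      by (rule nn_integral_cmult) measurable
    also have "\<dots> = ennreal (2 * D)"
      unfolding int using D by (subst ennreal_mult'[symmetric]) (auto simp: mult.commute)
    finally show "measure (gamma_distr \<alpha>) {x..} \<le> 2 * K * (1 + x) powr (\<alpha> - 1) * exp (- x)"
      using D unfolding measure_def
      by (subst (asm) D_def) (auto intro!: enn2real_leI simp: D_def mult_ac)
  qed (use K in simp)
qed

text \<open>
  For small \<open>t\<close> the finite total mass suffices. For large \<open>t\<close> every point of the superlevel set is at
  least \<open>ln t / 4\<close>, and the tail bound at a point close to its infimum gives the estimate.
\<close>

lemma gamma_distr_superlevel:
  fixes \<alpha> C :: real
  assumes "\<alpha> > 0" "C > 0"
  obtains c where "c \<ge> 0"
    "\<And>t. t > 1 \<Longrightarrow> measure (gamma_distr \<alpha>) {x \<in> {0<..}. t \<le> C * exp x * (1 + x) powr (1/2 - \<alpha>)}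
        \<le> c / (t * sqrt (ln t))"
proof -
  interpret finite_measure "gamma_distr \<alpha>" using assms(1) by (rule finite_measure_gamma_distr)
  obtain C1 where C1: "C1 > 0"
    "\<And>x. x \<ge> 1 \<Longrightarrow> measure (gamma_distr \<alpha>) {x..} \<le> C1 * (1 + x) powr (\<alpha> - 1) * exp (- x)"
    using gamma_distr_tail[OF assms(1)] by blast
  define V where "V = measure (gamma_distr \<alpha>) {0<..}"
  have V: "V \<ge> 0" by (simp add: V_def)
  \<comment> \<open>Chosen so that \<open>t > T\<close> gives \<open>ln t \<ge> 2 ln (max 1 C) + 8\<close>, whence \<open>x \<ge> ln t / 4 \<ge> 2\<close> on the superlevel set.\<close>
  define T where "T = (max 1 C)\<^sup>2 * exp 8"
  have T: "T > 1"
  proof -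
    have "1 * 1 < (max 1 C)\<^sup>2 * exp 8"
      by (rule mult_le_less_imp_less) auto
    then show ?thesis by (simp add: T_def)
  qed
  define c1 where "c1 = V * (T * sqrt (ln T))"
  define c2 where "c2 = 2 * (C1 * (2 powr \<bar>\<alpha> - 1\<bar> * exp 1 * C))"
  have c1: "c1 \<ge> 0" using V T by (simp add: c1_def)
  have c2: "c2 \<ge> 0" using C1 assms by (simp add: c2_def)
  show thesis
  proof (rule that[of "c1 + c2"])
    show "c1 + c2 \<ge> 0" using c1 c2 by simp
    fix t :: real
    assume t: "t > 1"
    define B where "B = {x \<in> {0<..}. t \<le> C * exp x * (1 + x) powr (1/2 - \<alpha>)}"
    have pos: "t * sqrt (ln t) > 0" using t by simp
    have "measure (gamma_distr \<alpha>) B \<le> c1 / (t * sqrt (ln t)) \<or>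
          measure (gamma_distr \<alpha>) B \<le> c2 / (t * sqrt (ln t))"
    proof (cases "t \<le> T")
      case True
      have "t * sqrt (ln t) \<le> T * sqrt (ln T)"
        using True t T by (intro mult_mono) auto
      then have "V * (t * sqrt (ln t)) \<le> c1"
        unfolding c1_def using V by (rule mult_left_mono)
      moreover have "measure (gamma_distr \<alpha>) B \<le> V"
        using bounded_measure[of B] by (simp add: V_def)
      ultimately show ?thesis
        using pos by (intro disjI1) (simp add: pos_le_divide_eq mult_right_mono order_trans)
    next
      case False
      have large: "ln t / 4 \<le> x" "2 \<le> x" if "x \<in> B" for x
      proof -
        have x: "x > 0" "t \<le> C * exp x * (1 + x) powr (1/2 - \<alpha>)" using that by (auto simp: B_def)
        note x(2)
        also have "(1 + x) powr (1/2 - \<alpha>) \<le> (1 + x) powr 1"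
          using assms x by (intro powr_mono) auto
        also have "(1 + x) powr 1 \<le> exp x" using x by simp
        finally have "t \<le> max 1 C * (exp x * exp x)"
          using assms(2) by (smt (verit) exp_gt_zero mult.assoc mult_left_mono mult_right_mono mult_pos_pos)
        then have "ln t \<le> ln (max 1 C * (exp x * exp x))"
          using t by (subst ln_le_cancel_iff) auto
        also have "\<dots> = ln (max 1 C) + 2 * x"
          by (simp add: ln_mult)
        finally have 1: "ln t \<le> ln (max 1 C) + 2 * x" .
        have "ln T < ln t" using False T by simp
        moreover have "ln T = 2 * ln (max 1 C) + 8"
          by (simp add: T_def ln_mult ln_realpow)
        moreover have "ln (max 1 C) \<ge> 0" by simp
        ultimately show "ln t / 4 \<le> x" "2 \<le> x" using 1 by linarith+
      qed
      show ?thesis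
      proof (cases "B = {}")
        case True
        then show ?thesis using c1 pos by simp
      next
        case False
        have bdd: "bdd_below B" using large(2) by (auto intro!: bdd_belowI)
        \<comment> \<open>A point of the set that is almost minimal; the half-line from \<open>x - 1\<close> then covers it.\<close>
        obtain x where x: "x \<in> B" "x < Inf B + 1"
          using cInf_lessD[OF False, of "Inf B + 1"] by auto
        have sub: "B \<subseteq> {x - 1..}"
        proof
          fix y assume "y \<in> B"
          then have "Inf B \<le> y" using bdd by (rule cInf_lower)
          then show "y \<in> {x - 1..}" using x(2) by simp
        qed
        have x2: "x \<ge> 2" "ln t / 4 \<le> x" using large[OF x(1)] by auto
        have tx: "t \<le> C * exp x * (1 + x) powr (1/2 - \<alpha>)" using x(1) by (simp add: B_def)
        have "measure (gamma_distr \<alpha>) B \<le> measure (gamma_distr \<alpha>) {x - 1..}"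
          using sub x2 by (intro finite_measure_mono emeasure_gamma_distr) auto
        also have "\<dots> \<le> C1 * (1 + (x - 1)) powr (\<alpha> - 1) * exp (- (x - 1))"
          using x2 by (intro C1) auto
        also have "\<dots> \<le> C1 * (2 powr \<bar>\<alpha> - 1\<bar> * (1 + x) powr (\<alpha> - 1)) * exp (- (x - 1))"
          using x2 C1 by (intro mult_right_mono mult_left_mono powr_le_powr_of_comparable) auto
        also have "\<dots> = C1 * (2 powr \<bar>\<alpha> - 1\<bar> * exp 1) * ((1 + x) powr (\<alpha> - 1) * exp (- x))"
          by (simp add: exp_diff exp_minus field_simps)
        also have "(1 + x) powr (\<alpha> - 1) * exp (- x) \<le> C / (t * sqrt (1 + x))"
        proof -
          have "t * ((1 + x) powr (\<alpha> - 1) * exp (- x))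
              \<le> C * exp x * (1 + x) powr (1/2 - \<alpha>) * ((1 + x) powr (\<alpha> - 1) * exp (- x))"
            using tx by (intro mult_right_mono) auto
          also have "\<dots> = C * ((1 + x) powr (1/2 - \<alpha>) * (1 + x) powr (\<alpha> - 1))"
            by (simp add: exp_minus field_simps)
          also have "(1 + x) powr (1/2 - \<alpha>) * (1 + x) powr (\<alpha> - 1) = (1 + x) powr (- (1/2))"
            by (simp add: powr_add[symmetric])
          also have "\<dots> = 1 / sqrt (1 + x)"
            using x2 by (simp add: powr_minus_divide powr_half_sqrt)
          finally show ?thesis using t x2 by (simp add: field_simps)
        qed
        also have "C / (t * sqrt (1 + x)) \<le> C / (t * (sqrt (ln t) / 2))"
        proof (intro divide_left_mono mult_left_mono)
          have "sqrt (ln t) \<le> sqrt (4 * (1 + x))"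
            using x2 by (intro real_sqrt_le_mono) auto
          then show "sqrt (ln t) / 2 \<le> sqrt (1 + x)"
            unfolding real_sqrt_mult by simp
        qed (use t x2 assms in auto)
        finally have "measure (gamma_distr \<alpha>) B
            \<le> C1 * (2 powr \<bar>\<alpha> - 1\<bar> * exp 1) * (C / (t * (sqrt (ln t) / 2)))"
          using C1 by (simp add: mult_left_mono)
        also have "\<dots> = c2 / (t * sqrt (ln t))"
          using t by (simp add: c2_def field_simps)
        finally show ?thesis by blast
      qed
    qed
    then have "measure (gamma_distr \<alpha>) B \<le> (c1 + c2) / (t * sqrt (ln t))"
    proof
      assume "measure (gamma_distr \<alpha>) B \<le> c1 / (t * sqrt (ln t))"
      also have "\<dots> \<le> (c1 + c2) / (t * sqrt (ln t))" using c2 pos by (intro divide_right_mono) auto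
      finally show ?thesis .
    next
      assume "measure (gamma_distr \<alpha>) B \<le> c2 / (t * sqrt (ln t))"
      also have "\<dots> \<le> (c1 + c2) / (t * sqrt (ln t))" using c1 pos by (intro divide_right_mono) auto
      finally show ?thesis .
    qed
    then show "measure (gamma_distr \<alpha>) {x \<in> {0<..}. t \<le> C * exp x * (1 + x) powr (1/2 - \<alpha>)}
        \<le> (c1 + c2) / (t * sqrt (ln t))"
      by (simp add: B_def)
  qed
qed

section \<open>The deviation inequality\<close>

theorem theorem4p3:
  fixes \<alpha> s :: real
  assumes "\<alpha> > 0" and "s > 0"
  shows "\<exists>c::real. \<forall>f::real \<Rightarrow> real.
           (\<forall>x>0. f x \<ge> 0) \<and> integrable (gamma_distr \<alpha>) f \<and> (LINT x|gamma_distr \<alpha>. f x) = 1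
           \<longrightarrow> (\<forall>t>1. measure (gamma_distr \<alpha>) {x \<in> {0<..}. laguerre_semigroup \<alpha> s f x \<ge> t}
                       \<le> c / (t * sqrt (ln t)))"
proof -
  interpret finite_measure "gamma_distr \<alpha>" using assms(1) by (rule finite_measure_gamma_distr)
  obtain C where C: "C > 0"
    "\<And>x y. x > 0 \<Longrightarrow> y > 0 \<Longrightarrow> laguerre_kernel \<alpha> s x y \<le> C * exp x * (1 + x) powr (1/2 - \<alpha>)"
    using laguerre_kernel_le[OF assms] by blast
  obtain c where c: "c \<ge> 0"
    "\<And>t. t > 1 \<Longrightarrow> measure (gamma_distr \<alpha>) {x \<in> {0<..}. t \<le> C * exp x * (1 + x) powr (1/2 - \<alpha>)}
        \<le> c / (t * sqrt (ln t))"
    using gamma_distr_superlevel[OF assms(1) C(1)] by blast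
  show ?thesis
  proof (intro exI[of _ c] allI impI, elim conjE)
    fix f :: "real \<Rightarrow> real" and t :: real
    assume f: "\<forall>x>0. f x \<ge> 0" "integrable (gamma_distr \<alpha>) f" "(LINT x|gamma_distr \<alpha>. f x) = 1"
      and t: "t > 1"
    have le: "laguerre_semigroup \<alpha> s f x \<le> C * exp x * (1 + x) powr (1/2 - \<alpha>)" if "x > 0" for x
    proof -
      \<comment> \<open>The integrability of the left-hand side is not needed: its integral is 0 otherwise.\<close>
      have "(LINT y|gamma_distr \<alpha>. laguerre_kernel \<alpha> s x y * f y)
          \<le> (LINT y|gamma_distr \<alpha>. C * exp x * (1 + x) powr (1/2 - \<alpha>) * f y)"
        using f C that by (intro integral_mono' integrable_mult_right mult_right_mono) auto
      then show ?thesis using f assms(2) by (simp add: laguerre_semigroup_def)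
    qed
    \<comment> \<open>Monotonicity only needs the larger set to be measurable, as \<open>measure\<close> is 0 on non-measurable sets.\<close>
    have "measure (gamma_distr \<alpha>) {x \<in> {0<..}. laguerre_semigroup \<alpha> s f x \<ge> t}
        \<le> measure (gamma_distr \<alpha>) {x \<in> {0<..}. t \<le> C * exp x * (1 + x) powr (1/2 - \<alpha>)}"
    proof (rule finite_measure_mono)
      have "{x \<in> {0<..}. t \<le> C * exp x * (1 + x) powr (1/2 - \<alpha>)} \<in> sets borel"
        by measurable
      then show "{x \<in> {0<..}. t \<le> C * exp x * (1 + x) powr (1/2 - \<alpha>)} \<in> sets (gamma_distr \<alpha>)"
        by (rule emeasure_gamma_distr) auto
    qed (use le in \<open>auto intro: order_trans\<close>)
    also have "\<dots> \<le> c / (t * sqrt (ln t))" using t by (rule c(2))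
    finally show "measure (gamma_distr \<alpha>) {x \<in> {0<..}. laguerre_semigroup \<alpha> s f x \<ge> t}
        \<le> c / (t * sqrt (ln t))" .
  qed
qed

end
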